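(* For any $n\in\mathbb{N}$, $n\ge 1$, the set $\mathrm{sl}^+(n)\cap\mathbb{R}^n_{\ge 0}$ is strictly convex.
   Context: $\mathbb{R}^n_{\ge 0}=\{x\in\mathbb{R}^n : x_i\ge 0 \text{ for all } i\}$ and $\mathrm{sl}^+(n)=\{x\in\mathbb{R}^n : \prod_{i=1}^n x_i\ge 1\}$. A set $K\subset\mathbb{R}^n$ is strictly convex if for all $x\ne y$ in $K$ and all $t\in(0,1)$ the point $tx+(1-t)y$ lies in the interior of $K$. *)

theory Defs
  imports "HOL-Analysis.Analysis"
begin

definition nonneg_orthant :: "(real ^ 'n) set"
  where "nonneg_orthant = {x. \<forall>i. 0 \<le> x $ i}"

(* No sign condition on the coordinates: (-1, -1) lies in this set when n = 2. *)
definition sl_plus :: "(real ^ 'n) set"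
  where "sl_plus = {x. (\<Prod>i\<in>UNIV. x $ i) \<ge> 1}"

definition strictly_convex :: "'a::real_normed_vector set \<Rightarrow> bool"
  where "strictly_convex K \<longleftrightarrow>
    (\<forall>x\<in>K. \<forall>y\<in>K. x \<noteq> y \<longrightarrow>
      (\<forall>t\<in>{0<..<1}. t *\<^sub>R x + (1 - t) *\<^sub>R y \<in> interior K))"

end

(* Points of the set have positive coordinates, so taking logarithms and using strict concavity
   of ln in each coordinate makes the coordinate product of a proper convex combination strictly
   greater than 1; positive vectors with product greater than 1 form an open subset. *)
theory Submission
  imports Defs
begin

text \<open>The right-hand side is the tangent to \<open>ln\<close> at \<open>z\<close>; the bound
  is \<open>ln u < u - 1\<close> for \<open>u = a / z\<close>, strict because \<open>u\<close>
  differs from 1.\<close>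

lemma ln_less_tangent:
  fixes a z :: real
  assumes "0 < a" "0 < z" "a \<noteq> z"
  shows "ln a < ln z + (a - z) / z"
proof -
  have "a / z \<noteq> 1" "0 < a / z"
    using assms by auto
  then have "ln (a / z) < a / z - 1"
    using ln_le_minus_one [of "a / z"] ln_eq_minus_one [of "a / z"] by linarith
  then show ?thesis
    using assms by (simp add: ln_div diff_divide_distrib)
qed

text \<open>Both values of \<open>ln\<close> are bounded by the tangent at the common point
  \<open>z = t * a + (1 - t) * b\<close>. In the weighted sum the linear terms cancel, leaving
  \<open>ln z\<close>.\<close>

lemma ln_strictly_concave:
  fixes a b t :: real
  assumes "0 < a" "0 < b" "a \<noteq> b" "0 < t" "t < 1"
  shows "t * ln a + (1 - t) * ln b < ln (t * a + (1 - t) * b)"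
proof -
  define z where "z = t * a + (1 - t) * b"
  \<comment> \<open>These identities serve twice: they show that \<open>z\<close> differs from both
    endpoints, and they make the linear terms cancel.\<close>
  have az: "a - z = (1 - t) * (a - b)" and bz: "b - z = t * (b - a)"
    by (simp_all add: z_def algebra_simps)
  have "0 < z"
    using assms by (simp add: z_def add_pos_pos)
  have "a \<noteq> z" "b \<noteq> z"
    using assms az bz by auto
  then have "t * ln a + (1 - t) * ln b
      < t * (ln z + (a - z) / z) + (1 - t) * (ln z + (b - z) / z)"
    using assms \<open>0 < z\<close> by (intro add_strict_mono mult_strict_left_mono ln_less_tangent) auto
  also have "\<dots> = ln z"
    unfolding az bz using \<open>0 < z\<close> by (simp add: field_simps)
  finally show ?thesis
    by (simp add: z_def)
qed

theorem lemma3p2: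
  shows "strictly_convex (sl_plus \<inter> nonneg_orthant :: (real ^ 'n) set)"
  unfolding strictly_convex_def
proof (intro ballI impI)
  fix x y :: "real ^ 'n" and t :: real
  assume x: "x \<in> sl_plus \<inter> nonneg_orthant" and y: "y \<in> sl_plus \<inter> nonneg_orthant"
    and "x \<noteq> y" and t: "t \<in> {0<..<1}"
  define z where "z = t *\<^sub>R x + (1 - t) *\<^sub>R y"
  \<comment> \<open>Strict inequalities make \<open>U\<close> open, so that it can witness that
    \<open>z\<close> is an interior point.\<close>
  define U :: "(real ^ 'n) set" where "U = (\<Inter>i. {w. 0 < w $ i}) \<inter> {w. 1 < (\<Prod>i\<in>UNIV. w $ i)}"
  have pos: "0 < w $ i" and ln_sum: "0 \<le> (\<Sum>i\<in>UNIV. ln (w $ i))"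
    if "w \<in> sl_plus \<inter> nonneg_orthant" for w :: "real ^ 'n" and i
  proof -
    have prod: "1 \<le> (\<Prod>i\<in>UNIV. w $ i)" and nonneg: "0 \<le> w $ j" for j
      using that by (auto simp: sl_plus_def nonneg_orthant_def)
    \<comment> \<open>The product bound rules out the boundary of the orthant, where logarithms
      would be of no use.\<close>
    have nonzero: "w $ j \<noteq> 0" for j
    proof
      assume "w $ j = 0"
      then have "(\<Prod>i\<in>UNIV. w $ i) = 0"
        by (intro prod_zero) auto
      with prod show False by simp
    qed
    have p: "0 < w $ j" for j
      using nonneg [of j] nonzero [of j] by linarith
    then show "0 < w $ i" .
    have "ln (\<Prod>i\<in>UNIV. w $ i) = (\<Sum>i\<in>UNIV. ln (w $ i))"
      by (intro ln_prod finite nonzero)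
    with prod show "0 \<le> (\<Sum>i\<in>UNIV. ln (w $ i))"
      by (metis ln_ge_zero)
  qed
  have z_pos: "0 < z $ i" for i
    using pos [OF x, of i] pos [OF y, of i] t by (simp add: z_def add_pos_pos)
  have "0 \<le> t * (\<Sum>i\<in>UNIV. ln (x $ i)) + (1 - t) * (\<Sum>i\<in>UNIV. ln (y $ i))"
    using ln_sum [OF x] ln_sum [OF y] t by simp
  also have "\<dots> = (\<Sum>i\<in>UNIV. t * ln (x $ i) + (1 - t) * ln (y $ i))"
    by (simp add: sum.distrib sum_distrib_left)
  also have "\<dots> < (\<Sum>i\<in>UNIV. ln (z $ i))"
  \<comment> \<open>Coordinates where \<open>x\<close> and \<open>y\<close> agree give equality, so
    strictness comes only from one where they differ; \<open>x \<noteq> y\<close> provides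
    it.\<close>
  proof (rule sum_strict_mono_ex1)
    have strict: "t * ln (x $ i) + (1 - t) * ln (y $ i) < ln (z $ i)" if "x $ i \<noteq> y $ i" for i
      using ln_strictly_concave [OF pos [OF x] pos [OF y] that, of t] t by (simp add: z_def)
    have eq: "t * ln (x $ i) + (1 - t) * ln (y $ i) = ln (z $ i)" if "x $ i = y $ i" for i
      using that by (simp add: z_def algebra_simps)
    show "\<forall>i\<in>UNIV. t * ln (x $ i) + (1 - t) * ln (y $ i) \<le> ln (z $ i)"
      using strict eq by (metis less_imp_le order_refl)
    show "\<exists>i\<in>UNIV. t * ln (x $ i) + (1 - t) * ln (y $ i) < ln (z $ i)"
      using \<open>x \<noteq> y\<close> strict by (auto simp: vec_eq_iff)
  qed simp
  also have "\<dots> = ln (\<Prod>i\<in>UNIV. z $ i)"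
    using z_pos by (intro ln_prod [symmetric] finite less_imp_neq [symmetric])
  \<comment> \<open>The chain shows that the logarithm of the product is positive; since the product
    itself is positive, it exceeds 1.\<close>
  finally have "1 < (\<Prod>i\<in>UNIV. z $ i)"
    using z_pos by (simp add: prod_pos)
  with z_pos have "z \<in> U"
    by (simp add: U_def)
  moreover have "open U"
    unfolding U_def
    by (intro open_Int open_INT open_Collect_less continuous_intros ballI finite)
  moreover have "U \<subseteq> sl_plus \<inter> nonneg_orthant"
    by (auto simp: U_def sl_plus_def nonneg_orthant_def less_imp_le)
  ultimately show "t *\<^sub>R x + (1 - t) *\<^sub>R y \<in> interior (sl_plus \<inter> nonneg_orthant)"
    unfolding z_def [symmetric] by (blast intro: interiorI)
qed

end
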